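(* Euler Shift is consistent: for every mode $x_*$ of $f$ and every $x_0$ in the basin of attraction of $x_*$, there is $\rho_0>0$ such that for all $\rho\in(0,\rho_0]$ the Euler Shift sequence with step size $\rho$ initialized at $x_0$ converges to $x_*$.
   Context: Density. $f$ is a probability density on $\mathbb{R}^d$ with respect to Lebesgue measure such that: (i) $f(x)\to0$ as $\|x\|\to\infty$; (ii) $f$ is twice differentiable everywhere, and $f$, $\nabla f$, $\nabla^2 f$ are bounded and uniformly continuous; (iii) the Hessian $\nabla^2 f$ is non-singular at every critical point of $f$. A mode is a local maximum of $f$. Gradient flow. For $x\in\mathbb{R}^d$, $\gamma_x:[0,\infty)\to\mathbb{R}^d$ is the solution of $\gamma_x(0)=x$, $\dot\gamma_x(t)=\nabla f(\gamma_x(t))$; $\gamma_x(t)$ converges to a critical point of $f$ as $t\to\infty$, denoted $\gamma_x(\infty)$. The basin of attraction of $x_*$ is $\{x:\gamma_x(\infty)=x_*\}$. Euler Shift. Given $\rho>0$ and a starting point $x_0$: $x(0)=x_0$ and $x(k+1)=x(k)+\rho\nabla f(x(k))$ for $k\ge0$. *)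

theory Defs
  imports "HOL-Analysis.Analysis"
begin

definition gradient :: "(real^'n \<Rightarrow> real) \<Rightarrow> real^'n \<Rightarrow> real^'n" where
  "gradient f x = (THE D. GDERIV f x :> D)"

lemma GDERIV_unique:
  assumes "GDERIV f x :> D" "GDERIV f x :> E"
  shows "D = E"
proof -
  have "(\<lambda>h. h \<bullet> D) = (\<lambda>h. h \<bullet> E)"
    using assms unfolding gderiv_def by (rule has_derivative_unique)
  then show ?thesis
    by (metis vector_eq_ldot)
qed

lemma GDERIV_gradient:
  fixes f :: "real^'n \<Rightarrow> real"
  assumes "f differentiable (at x)"
  shows "GDERIV f x :> gradient f x"
proof -
  obtain f' where f': "(f has_derivative f') (at x)"
    using assms by (auto simp: differentiable_def)
  then have "linear f'"
    by (rule has_derivative_linear)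
  then have "f' = (\<lambda>h. h \<bullet> adjoint f' 1)"
    by (simp add: fun_eq_iff adjoint_works)
  with f' have "GDERIV f x :> adjoint f' 1"
    by (simp add: gderiv_def)
  then show ?thesis
    unfolding gradient_def by (rule theI) (blast intro: GDERIV_unique \<open>GDERIV f x :> adjoint f' 1\<close>)
qed

definition hessian :: "(real^'n \<Rightarrow> real) \<Rightarrow> real^'n \<Rightarrow> real^'n^'n" where
  "hessian f x = jacobian (gradient f) (at x)"

definition prob_density :: "(real^'n \<Rightarrow> real) \<Rightarrow> bool" where
  "prob_density f \<longleftrightarrow> (\<forall>x. 0 \<le> f x) \<and> has_bochner_integral lborel f 1"

definition twice_differentiable :: "(real^'n \<Rightarrow> real) \<Rightarrow> bool" where
  "twice_differentiable f \<longleftrightarrow>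
     (\<forall>x. f differentiable (at x)) \<and> (\<forall>x. gradient f differentiable (at x))"

definition bounded_unif_cont ::
  "(real^'n \<Rightarrow> 'b::real_normed_vector) \<Rightarrow> bool" where
  "bounded_unif_cont g \<longleftrightarrow> bounded (range g) \<and> uniformly_continuous_on UNIV g"

definition regular_density :: "(real^'n \<Rightarrow> real) \<Rightarrow> bool" where
  "regular_density f \<longleftrightarrow>
     prob_density f \<and>
     (f \<longlongrightarrow> 0) at_infinity \<and>
     twice_differentiable f \<and>
     bounded_unif_cont f \<and> bounded_unif_cont (gradient f) \<and> bounded_unif_cont (hessian f) \<and>
     (\<forall>x. gradient f x = 0 \<longrightarrow> invertible (hessian f x))"

definition is_mode :: "(real^'n \<Rightarrow> real) \<Rightarrow> real^'n \<Rightarrow> bool" where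
  "is_mode f x \<longleftrightarrow> (\<forall>\<^sub>F y in nhds x. f y \<le> f x)"

definition gradient_flow ::
  "(real^'n \<Rightarrow> real) \<Rightarrow> real^'n \<Rightarrow> (real \<Rightarrow> real^'n) \<Rightarrow> bool" where
  "gradient_flow f x \<gamma> \<longleftrightarrow>
     \<gamma> 0 = x \<and>
     (\<forall>t\<ge>0. (\<gamma> has_vector_derivative gradient f (\<gamma> t)) (at t within {0..}))"

text \<open>
  For a regular density the gradient is Lipschitz, so the solution of the flow equation
  on \<open>[0, \<infinity>)\<close> exists and is unique. The existential quantifier below therefore just names
  that solution, whose values at negative times are left unconstrained.
\<close>

definition basin_of_attraction :: "(real^'n \<Rightarrow> real) \<Rightarrow> real^'n \<Rightarrow> (real^'n) set" where
  "basin_of_attraction f z = {x. \<exists>\<gamma>. gradient_flow f x \<gamma> \<and> (\<gamma> \<longlongrightarrow> z) at_top}"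

primrec euler_shift ::
  "(real^'n \<Rightarrow> real) \<Rightarrow> real \<Rightarrow> real^'n \<Rightarrow> nat \<Rightarrow> real^'n" where
  "euler_shift f \<rho> x\<^sub>0 0 = x\<^sub>0"
| "euler_shift f \<rho> x\<^sub>0 (Suc k) =
     euler_shift f \<rho> x\<^sub>0 k + \<rho> *\<^sub>R gradient f (euler_shift f \<rho> x\<^sub>0 k)"

end

theory Submission
  imports Defs
begin

text \<open>
  The proof combines a trapping region for the discrete iteration near the mode with the
  finite-time accuracy of Euler's method.

  A bounded Hessian makes the gradient Lipschitz, with constant \<open>L\<close> say.
  For step sizes up to \<open>1 / (2 * L)\<close> the density then stays, on the whole segment
  joining two consecutive iterates, at or above its value at the start, and a full step gains
  at least \<open>\<rho> / 2\<close> times the squared gradient norm (\<open>gradient_step_ascent\<close>). An invertible Hessian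
  makes the mode \<open>z\<close> an isolated critical point, and an isolated critical point that is a local maximum is a strict one: a nearby point of equal
  height would itself be a local maximum, hence critical. So on a small sphere around \<open>z\<close> the
  density is at most \<open>c\<close> for some \<open>c < f z\<close>. An iterate inside that ball at height above
  \<open>c\<close> cannot leave it, because its segment would have to cross the sphere at a height above
  \<open>c\<close>. The heights are bounded, so the squared gradient norms are summable and the iterates
  approach the only critical point in the ball, namely \<open>z\<close> (\<open>strict_local_max_traps_ascent\<close>).

  It remains to enter the trapping region. The flow line from \<open>x\<^sub>0\<close> lies in the open trapping set
  at some finite time \<open>T\<close>, and Euler's method follows the flow up to time \<open>T\<close> with
  error proportional to \<open>\<rho>\<close> (\<open>euler_near_flow\<close>), so a small enough \<open>\<rho>\<close> brings an iterate into the trapping region.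
\<close>

section \<open>Ascent along a gradient step\<close>

text \<open>
  Along the segment the slope is the inner product of the gradient with \<open>F x\<close>. The
  gradient differs from \<open>F x\<close> by at most \<open>L * t * norm (F x)\<close>, which is at most half of
  \<open>norm (F x)\<close>, so the slope is at least half of its value at \<open>x\<close>.
\<close>

lemma gradient_step_ascent:
  fixes f :: "'a::real_inner \<Rightarrow> real"
  assumes grad: "\<And>x. GDERIV f x :> F x"
    and lip: "L-lipschitz_on UNIV F"
    and t: "0 \<le> t" "t * L \<le> 1 / 2"
  shows "f x + t / 2 * (norm (F x))\<^sup>2 \<le> f (x + t *\<^sub>R F x)"
proof -
  define \<phi> where "\<phi> s = f (x + s *\<^sub>R F x) - s / 2 * (norm (F x))\<^sup>2" for s
  have "\<exists>y. DERIV \<phi> s :> y \<and> y \<ge> 0" if s: "0 \<le> s" "s \<le> t" for s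
  proof -
    let ?y = "x + s *\<^sub>R F x"
    have "(f has_derivative (\<lambda>h. h \<bullet> F ?y)) (at ?y)"
      using grad by (simp add: gderiv_def)
    then have "((\<lambda>s. f (x + s *\<^sub>R F x)) has_derivative (\<lambda>h. (h *\<^sub>R F x) \<bullet> F ?y)) (at s)"
      by (rule has_derivative_compose[rotated]) (auto intro!: derivative_eq_intros)
    then have 1: "((\<lambda>s. f (x + s *\<^sub>R F x)) has_real_derivative F x \<bullet> F ?y) (at s)"
      by (simp add: has_field_derivative_def mult.commute[of _ "F x \<bullet> F ?y"])
    have D: "DERIV \<phi> s :> F x \<bullet> F ?y - (norm (F x))\<^sup>2 / 2"
      unfolding \<phi>_def by (auto intro!: derivative_eq_intros 1)
    have "L \<ge> 0" using lip by (rule lipschitz_on_nonneg)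
    have "norm (F ?y - F x) \<le> L * (s * norm (F x))"
      using lipschitz_onD[OF lip, of ?y x] s by (simp add: dist_norm)
    also have "\<dots> = (s * L) * norm (F x)" by simp
    also have "\<dots> \<le> (1 / 2) * norm (F x)"
      using mult_right_mono[OF s(2) \<open>L \<ge> 0\<close>] t by (intro mult_right_mono norm_ge_zero) linarith
    finally have "norm (F ?y - F x) \<le> norm (F x) / 2" by simp
    then have "\<bar>F x \<bullet> (F ?y - F x)\<bar> \<le> norm (F x) * (norm (F x) / 2)"
      by (meson Cauchy_Schwarz_ineq2 mult_left_mono norm_ge_zero order_trans)
    then have "- (F x \<bullet> (F ?y - F x)) \<le> (norm (F x))\<^sup>2 / 2"
      by (simp add: abs_le_iff power2_eq_square)
    then have "F x \<bullet> F ?y - (norm (F x))\<^sup>2 / 2 \<ge> 0"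
      by (simp add: inner_diff_right power2_norm_eq_inner)
    with D show ?thesis by blast
  qed
  then have "\<phi> 0 \<le> \<phi> t"
    by (intro DERIV_nonneg_imp_nondecreasing[OF t(1)])
  then show ?thesis by (simp add: \<phi>_def)
qed

section \<open>The trapping region of a strict local maximum\<close>

lemma injective_derivative_isolated_zero:
  fixes F :: "'a::real_normed_vector \<Rightarrow> 'b::euclidean_space"
  assumes der: "(F has_derivative F') (at z)" and inj: "inj F'" and "F z = 0"
  shows "\<forall>\<^sub>F x in at z. F x \<noteq> 0"
proof -
  have lin: "linear F'" using der by (rule has_derivative_linear)
  obtain B where B: "B > 0" "\<And>x. B * norm x \<le> norm (F' x)"
    using linear_inj_bounded_below_pos[OF lin inj] by blast
  have "((\<lambda>x. norm (F x - F z - F' (x - z)) / norm (x - z)) \<longlongrightarrow> 0) (at z)"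
    using der by (simp add: has_derivative_iff_norm)
  then have "\<forall>\<^sub>F x in at z. norm (F x - F z - F' (x - z)) / norm (x - z) < B"
    using B(1) by (rule order_tendstoD)
  moreover have "\<forall>\<^sub>F x in at z. x \<noteq> z"
    by (simp add: eventually_at_filter)
  ultimately show ?thesis
  proof eventually_elim
    case (elim x)
    then have "norm (F x - F' (x - z)) < B * norm (x - z)"
      by (simp add: \<open>F z = 0\<close> divide_less_eq)
    with B(2)[of "x - z"] show ?case by auto
  qed
qed

lemma gradient_zero_at_local_max:
  assumes "GDERIV f x :> D" and "\<forall>\<^sub>F y in nhds x. f y \<le> f x"
  shows "D = 0"
proof -
  have "(\<lambda>h. h \<bullet> D) = (\<lambda>h. 0)"
    using assms by (auto simp: gderiv_def eventually_at_filter
        elim!: has_derivative_local_max eventually_mono)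
  then have "D \<bullet> D = 0" by metis
  then show ?thesis by simp
qed

text \<open>
  A point \<open>x\<close> near \<open>z\<close> has a neighbourhood on which \<open>f\<close> is at most \<open>f z\<close>.
  If \<open>f x = f z\<close> then \<open>x\<close> is a local maximum too, hence critical.
\<close>

lemma isolated_critical_local_max_strict:
  assumes grad: "\<And>x. GDERIV f x :> F x"
    and max: "\<forall>\<^sub>F y in nhds z. f y \<le> f z"
    and iso: "\<forall>\<^sub>F x in at z. F x \<noteq> 0"
  shows "\<forall>\<^sub>F x in at z. f x < f z"
proof -
  have "\<forall>\<^sub>F x in nhds z. \<forall>\<^sub>F y in nhds x. f y \<le> f z"
    using max by (simp add: eventually_eventually)
  then have "\<forall>\<^sub>F x in at z. (\<forall>\<^sub>F y in nhds x. f y \<le> f z)"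
    by (simp add: eventually_at_filter eventually_mono)
  with iso show ?thesis
  proof eventually_elim
    case (elim x)
    have le: "f x \<le> f z"
      using elim(2) by (rule eventually_nhds_x_imp_x)
    have "f x \<noteq> f z"
    proof
      assume "f x = f z"
      with elim(2) have "F x = 0"
        using gradient_zero_at_local_max[OF grad, of x] by simp
      with elim(1) show False by simp
    qed
    with le show ?case by simp
  qed
qed

lemma tendsto_unique_zero_compact:
  fixes F :: "'a::metric_space \<Rightarrow> 'b::real_normed_vector"
  assumes "compact K" and cont: "continuous_on K F"
    and unique: "\<And>y. y \<in> K \<Longrightarrow> F y = 0 \<Longrightarrow> y = z"
    and inK: "\<And>k. x k \<in> K" and lim: "(\<lambda>k. F (x k)) \<longlonglongrightarrow> 0"
  shows "x \<longlonglongrightarrow> z"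
proof (rule tendstoI)
  fix e :: real assume "e > 0"
  let ?C = "K - ball z e"
  have C: "compact ?C" using \<open>compact K\<close> by (rule compact_diff) simp
  show "\<forall>\<^sub>F k in sequentially. dist (x k) z < e"
  proof (cases "?C = {}")
    case True
    then have "x k \<in> ball z e" for k using inK by blast
    then show ?thesis by (simp add: dist_commute)
  next
    case False
    have "continuous_on ?C (\<lambda>y. norm (F y))"
      by (intro continuous_on_norm continuous_on_subset[OF cont]) auto
    then obtain w where w: "w \<in> ?C" "\<And>y. y \<in> ?C \<Longrightarrow> norm (F w) \<le> norm (F y)"
      using continuous_attains_inf[OF C False] by blast
    have "F w \<noteq> 0" using w(1) unique \<open>e > 0\<close> by auto
    then have "\<forall>\<^sub>F k in sequentially. norm (F (x k)) < norm (F w)"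
      using order_tendstoD(2)[OF tendsto_norm[OF lim], of "norm (F w)"] by simp
    then show ?thesis
    proof eventually_elim
      case (elim k)
      then have "x k \<notin> ?C" using w(2)[of "x k"] by force
      with inK[of k] show ?case by (simp add: dist_commute)
    qed
  qed
qed

text \<open>
  A common trapping region \<open>U\<close> serves all admissible step sizes and all starting times; this
  uniformity is what lets the step size be chosen afterwards, so small that the iteration
  reaches \<open>U\<close>.
\<close>

lemma strict_local_max_traps_ascent:
  fixes f :: "'a::euclidean_space \<Rightarrow> real"
  assumes grad: "\<And>x. GDERIV f x :> F x"
    and lip: "L-lipschitz_on UNIV F"
    and max: "\<forall>\<^sub>F y in nhds z. f y \<le> f z"
    and iso: "\<forall>\<^sub>F x in at z. F x \<noteq> 0"
  obtains U where "open U" "z \<in> U"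
    "\<And>\<rho> x m. \<lbrakk>0 < \<rho>; \<rho> * L \<le> 1 / 2; \<And>k. x (Suc k) = x k + \<rho> *\<^sub>R F (x k); x m \<in> U\<rbrakk>
      \<Longrightarrow> x \<longlonglongrightarrow> z"
proof -
  have contF: "continuous_on S F" for S
    using lip by (meson continuous_on_subset lipschitz_on_continuous_on subset_UNIV)
  have contf: "continuous_on S f" for S
    by (intro continuous_at_imp_continuous_on ballI has_derivative_continuous[OF grad[unfolded gderiv_def]])
  have "\<forall>\<^sub>F x in at z. F x \<noteq> 0 \<and> f x < f z"
    using iso isolated_critical_local_max_strict[OF grad max iso] by (rule eventually_conj)
  then obtain r0 where r0: "r0 > 0" "\<And>x. x \<noteq> z \<Longrightarrow> dist x z < r0 \<Longrightarrow> F x \<noteq> 0 \<and> f x < f z"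
    unfolding eventually_at by blast
  define r where "r = r0 / 2"
  have r: "r > 0" "\<And>x. x \<noteq> z \<Longrightarrow> x \<in> cball z r \<Longrightarrow> F x \<noteq> 0 \<and> f x < f z"
    using r0 by (auto simp: r_def dist_commute)
  obtain c where c: "c < f z" "\<And>y. y \<in> sphere z r \<Longrightarrow> f y \<le> c"
  proof -
    obtain w where w: "w \<in> sphere z r" "\<And>y. y \<in> sphere z r \<Longrightarrow> f y \<le> f w"
      using continuous_attains_sup[OF compact_sphere _ contf, of z r] r(1) by auto
    moreover have "w \<noteq> z" using w(1) r(1) by auto
    ultimately show ?thesis using that r(2)[of w] by auto
  qed
  define U where "U = ball z r \<inter> {x. c < f x}"
  have "open U"
    unfolding U_def using contf[of UNIV] by (intro open_Int open_ball open_Collect_less) auto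
  moreover have "z \<in> U"
    using r c by (simp add: U_def)
  moreover have "x \<longlonglongrightarrow> z"
    if \<rho>: "0 < \<rho>" "\<rho> * L \<le> 1 / 2" and rec: "\<And>k. x (Suc k) = x k + \<rho> *\<^sub>R F (x k)" and m: "x m \<in> U"
    for \<rho> x m
  proof -
    have L: "L \<ge> 0" using lip by (rule lipschitz_on_nonneg)
    have ascent: "f y + s / 2 * (norm (F y))\<^sup>2 \<le> f (y + s *\<^sub>R F y)" if "0 \<le> s" "s \<le> \<rho>" for y s
      using that \<rho> mult_right_mono[OF that(2) L] by (intro gradient_step_ascent[OF grad lip]) linarith+
    have step: "y + \<rho> *\<^sub>R F y \<in> U" if y: "y \<in> U" for y
    proof -
      have high: "c < f (y + s *\<^sub>R F y)" if "0 \<le> s" "s \<le> \<rho>" for s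
      proof -
        have "0 \<le> s / 2 * (norm (F y))\<^sup>2" using that by simp
        then show ?thesis using ascent[OF that, of y] y by (simp add: U_def)
      qed
      have "y + \<rho> *\<^sub>R F y \<in> ball z r"
      proof (rule ccontr)
        assume "y + \<rho> *\<^sub>R F y \<notin> ball z r"
        \<comment> \<open>the segment would then cross the sphere, where \<open>f\<close> is too small\<close>
        then have "\<exists>s\<ge>0. s \<le> \<rho> \<and> dist z (y + s *\<^sub>R F y) = r"
          using y \<rho> by (intro IVT') (auto simp: U_def intro!: continuous_intros)
        then obtain s where "0 \<le> s" "s \<le> \<rho>" "y + s *\<^sub>R F y \<in> sphere z r"
          by (auto simp: sphere_def)
        then show False using high[of s] c(2) by fastforce
      qed
      with high[of \<rho>] \<rho> show ?thesis by (simp add: U_def)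
    qed
    have inU: "x (k + m) \<in> U" for k
      by (induction k) (use m step rec in auto)
    have bound: "f y \<le> f z" if "y \<in> U" for y
      using r(2)[of y] that by (cases "y = z") (auto simp: U_def)
    have inc: "f (x (k + m)) + \<rho> / 2 * (norm (F (x (k + m))))\<^sup>2 \<le> f (x (Suc (k + m)))" for k
      using ascent[of \<rho> "x (k + m)"] \<rho> by (simp add: rec)
    have "summable (\<lambda>k. \<rho> / 2 * (norm (F (x (k + m))))\<^sup>2)"
    proof (rule summableI_nonneg_bounded)
      fix n
      have "(\<Sum>k<n. \<rho> / 2 * (norm (F (x (k + m))))\<^sup>2) \<le> f (x (n + m)) - f (x m)"
      proof (induction n)
        case (Suc n)
        then show ?case using inc[of n] by simp
      qed simp
      also have "\<dots> \<le> f z - f (x m)" using bound[OF inU] by simp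
      finally show "(\<Sum>k<n. \<rho> / 2 * (norm (F (x (k + m))))\<^sup>2) \<le> f z - f (x m)" .
    qed (use \<rho> in auto)
    then have "(\<lambda>k. \<rho> / 2 * (norm (F (x (k + m))))\<^sup>2) \<longlonglongrightarrow> 0"
      by (rule summable_LIMSEQ_zero)
    then have "(\<lambda>k. 2 / \<rho> * (\<rho> / 2 * (norm (F (x (k + m))))\<^sup>2)) \<longlonglongrightarrow> 0"
      by (rule tendsto_mult_right_zero)
    then have "(\<lambda>k. (norm (F (x (k + m))))\<^sup>2) \<longlonglongrightarrow> 0"
      using \<rho> by simp
    then have "(\<lambda>k. F (x (k + m))) \<longlonglongrightarrow> 0"
      by (simp add: tendsto_norm_zero_iff)
    then have "(\<lambda>k. x (k + m)) \<longlonglongrightarrow> z"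
    proof (rule tendsto_unique_zero_compact[OF compact_cball[of z r] contF, rotated -1])
      show "x (k + m) \<in> cball z r" for k using inU[of k] by (simp add: U_def)
      show "y = z" if "y \<in> cball z r" "F y = 0" for y using r(2)[of y] that by blast
    qed
    then show ?thesis by (rule LIMSEQ_offset)
  qed
  ultimately show thesis by (rule that)
qed

section \<open>Accuracy of Euler's method on a bounded time interval\<close>

lemma flow_lipschitz:
  fixes \<gamma> :: "real \<Rightarrow> 'a::real_normed_vector"
  assumes flow: "\<And>t. t \<ge> 0 \<Longrightarrow> (\<gamma> has_vector_derivative F (\<gamma> t)) (at t within {0..})"
    and M: "\<And>x. norm (F x) \<le> M" and "0 \<le> s" "0 \<le> t"
  shows "norm (\<gamma> s - \<gamma> t) \<le> M * \<bar>s - t\<bar>"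
proof -
  have "norm (\<gamma> s - \<gamma> t) \<le> M * norm (s - t)"
    using flow assms(3,4)
    by (intro differentiable_bound[of "{0..}" \<gamma> "\<lambda>u h. h *\<^sub>R F (\<gamma> u)"])
      (auto simp: has_vector_derivative_def mult.commute[of M] intro!: onorm_le mult_left_mono M)
  then show ?thesis by simp
qed

text \<open>
  During one step the flow moves by at most \<open>M * \<rho>\<close>, so its velocity changes by at most
  \<open>L * (M * \<rho>)\<close>.
\<close>

lemma euler_local_error:
  fixes \<gamma> :: "real \<Rightarrow> 'a::real_normed_vector"
  assumes flow: "\<And>t. t \<ge> 0 \<Longrightarrow> (\<gamma> has_vector_derivative F (\<gamma> t)) (at t within {0..})"
    and M: "\<And>x. norm (F x) \<le> M" and lip: "L-lipschitz_on UNIV F"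
    and "0 \<le> t" "0 \<le> \<rho>"
  shows "norm (\<gamma> (t + \<rho>) - \<gamma> t - \<rho> *\<^sub>R F (\<gamma> t)) \<le> \<rho> * (L * (M * \<rho>))"
proof -
  have L: "L \<ge> 0" using lip by (rule lipschitz_on_nonneg)
  have M0: "M \<ge> 0" using M norm_ge_zero order_trans by blast
  have "norm (\<gamma> (t + \<rho>) - \<gamma> t - (t + \<rho> - t) *\<^sub>R F (\<gamma> t)) \<le> norm (t + \<rho> - t) * (L * (M * \<rho>))"
  proof (rule vector_differentiable_bound_linearization[where S = "{t..t + \<rho>}"])
    fix s assume s: "s \<in> {t..t + \<rho>}"
    show "(\<gamma> has_vector_derivative F (\<gamma> s)) (at s within {t..t + \<rho>})"
      using flow[of s] s \<open>0 \<le> t\<close> by (auto intro: has_vector_derivative_within_subset)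
    have "norm (F (\<gamma> s) - F (\<gamma> t)) \<le> L * norm (\<gamma> s - \<gamma> t)"
      using lipschitz_onD[OF lip, of "\<gamma> s" "\<gamma> t"] by (simp add: dist_norm)
    also have "\<dots> \<le> L * (M * \<bar>s - t\<bar>)"
      using flow_lipschitz[OF flow M, of s t] s \<open>0 \<le> t\<close> L by (intro mult_left_mono) auto
    also have "\<dots> \<le> L * (M * \<rho>)"
      using s L M0 by (intro mult_left_mono) auto
    finally show "norm (F (\<gamma> s) - F (\<gamma> t)) \<le> L * (M * \<rho>)" .
  qed (use \<open>0 \<le> \<rho>\<close> in \<open>auto simp: closed_segment_eq_real_ivl\<close>)
  then show ?thesis using \<open>0 \<le> \<rho>\<close> by simp
qed

text \<open>
  One step multiplies the accumulated error by at most \<open>1 + \<rho> * L\<close> and adds a local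
  error of at most \<open>\<rho>\<^sup>2 * L * M\<close>. The bound below is the exact solution of this recurrence
  with initial value \<open>0\<close>.
\<close>

lemma euler_global_error:
  fixes \<gamma> :: "real \<Rightarrow> 'a::real_normed_vector"
  assumes flow: "\<And>t. t \<ge> 0 \<Longrightarrow> (\<gamma> has_vector_derivative F (\<gamma> t)) (at t within {0..})"
    and M: "\<And>x. norm (F x) \<le> M" and lip: "L-lipschitz_on UNIV F" and "0 \<le> \<rho>"
    and rec: "\<And>k. x (Suc k) = x k + \<rho> *\<^sub>R F (x k)" and x0: "x 0 = \<gamma> 0"
  shows "norm (x k - \<gamma> (real k * \<rho>)) \<le> \<rho> * M * ((1 + \<rho> * L) ^ k - 1)"
proof (induction k)
  case 0
  then show ?case by (simp add: x0)
next
  case (Suc k)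
  let ?t = "real k * \<rho>"
  have L: "L \<ge> 0" using lip by (rule lipschitz_on_nonneg)
  have loc: "norm (\<gamma> (?t + \<rho>) - \<gamma> ?t - \<rho> *\<^sub>R F (\<gamma> ?t)) \<le> \<rho> * (L * (M * \<rho>))"
    using \<open>0 \<le> \<rho>\<close> by (intro euler_local_error[OF flow M lip]) auto
  have lipk: "norm (F (x k) - F (\<gamma> ?t)) \<le> L * norm (x k - \<gamma> ?t)"
    using lipschitz_onD[OF lip, of "x k" "\<gamma> ?t"] by (simp add: dist_norm)
  have "x (Suc k) - \<gamma> (real (Suc k) * \<rho>) =
      (x k - \<gamma> ?t) + \<rho> *\<^sub>R (F (x k) - F (\<gamma> ?t)) - (\<gamma> (?t + \<rho>) - \<gamma> ?t - \<rho> *\<^sub>R F (\<gamma> ?t))"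
    by (simp add: rec algebra_simps)
  also have "norm \<dots> \<le> norm (x k - \<gamma> ?t) + norm (\<rho> *\<^sub>R (F (x k) - F (\<gamma> ?t)))
      + norm (\<gamma> (?t + \<rho>) - \<gamma> ?t - \<rho> *\<^sub>R F (\<gamma> ?t))"
    by (rule order_trans[OF norm_triangle_ineq4 add_right_mono[OF norm_triangle_ineq]])
  also have "\<dots> \<le> norm (x k - \<gamma> ?t) + \<rho> * (L * norm (x k - \<gamma> ?t)) + \<rho> * (L * (M * \<rho>))"
    using loc lipk \<open>0 \<le> \<rho>\<close> by (intro add_mono) (auto intro: mult_left_mono)
  also have "\<dots> = (1 + \<rho> * L) * norm (x k - \<gamma> ?t) + \<rho> * (L * (M * \<rho>))"
    by (simp add: algebra_simps)
  also have "\<dots> \<le> (1 + \<rho> * L) * (\<rho> * M * ((1 + \<rho> * L) ^ k - 1)) + \<rho> * (L * (M * \<rho>))"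
    using Suc L \<open>0 \<le> \<rho>\<close> by (intro add_right_mono mult_left_mono) auto
  also have "\<dots> = \<rho> * M * ((1 + \<rho> * L) ^ Suc k - 1)"
    by (simp add: algebra_simps)
  finally show ?case .
qed

lemma euler_near_flow:
  fixes \<gamma> :: "real \<Rightarrow> 'a::real_normed_vector"
  assumes flow: "\<And>t. t \<ge> 0 \<Longrightarrow> (\<gamma> has_vector_derivative F (\<gamma> t)) (at t within {0..})"
    and M: "\<And>x. norm (F x) \<le> M" and lip: "L-lipschitz_on UNIV F" and "0 < \<rho>" "0 \<le> T"
    and rec: "\<And>k. x (Suc k) = x k + \<rho> *\<^sub>R F (x k)" and x0: "x 0 = \<gamma> 0"
  shows "\<exists>k. norm (x k - \<gamma> T) \<le> \<rho> * (M * exp (L * T))"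
proof -
  have L: "L \<ge> 0" using lip by (rule lipschitz_on_nonneg)
  have M0: "M \<ge> 0" using M norm_ge_zero order_trans by blast
  define k where "k = nat \<lfloor>T / \<rho>\<rfloor>"
  have "real k = of_int \<lfloor>T / \<rho>\<rfloor>" using \<open>0 < \<rho>\<close> \<open>0 \<le> T\<close> by (simp add: k_def)
  then have "real k \<le> T / \<rho>" "T / \<rho> < real k + 1" by linarith+
  then have k: "real k * \<rho> \<le> T" "T < real k * \<rho> + \<rho>"
    using \<open>0 < \<rho>\<close> by (simp_all add: field_simps)
  have "(1 + \<rho> * L) ^ k \<le> exp (\<rho> * L) ^ k"
    using L \<open>0 < \<rho>\<close> by (intro power_mono exp_ge_add_one_self) auto
  also have "\<dots> = exp (L * (real k * \<rho>))"
    by (simp add: exp_of_nat_mult[symmetric] mult_ac)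
  also have "\<dots> \<le> exp (L * T)"
    using k L by (simp add: mult_left_mono)
  finally have pow: "(1 + \<rho> * L) ^ k \<le> exp (L * T)" .
  have "norm (x k - \<gamma> T) \<le> norm (x k - \<gamma> (real k * \<rho>)) + norm (\<gamma> (real k * \<rho>) - \<gamma> T)"
    using norm_triangle_ineq[of "x k - \<gamma> (real k * \<rho>)" "\<gamma> (real k * \<rho>) - \<gamma> T"] by simp
  also have "\<dots> \<le> \<rho> * M * ((1 + \<rho> * L) ^ k - 1) + M * \<bar>real k * \<rho> - T\<bar>"
    using \<open>0 < \<rho>\<close> \<open>0 \<le> T\<close>
    by (intro add_mono euler_global_error[OF flow M lip _ rec x0] flow_lipschitz[OF flow M]) auto
  also have "\<dots> \<le> \<rho> * M * (exp (L * T) - 1) + M * \<rho>"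
    using pow k M0 \<open>0 < \<rho>\<close> by (intro add_mono mult_left_mono) auto
  also have "\<dots> = \<rho> * (M * exp (L * T))"
    by (simp add: algebra_simps)
  finally show ?thesis by blast
qed

section \<open>Consistency of Euler Shift\<close>

lemma hessian_has_derivative:
  assumes "gradient f differentiable (at x)"
  shows "(gradient f has_derivative (\<lambda>h. hessian f x *v h)) (at x)"
  using assms by (simp add: hessian_def jacobian_works)

lemma bounded_hessian_lipschitz_gradient:
  fixes f :: "real^'n \<Rightarrow> real"
  assumes diff: "\<And>x. gradient f differentiable (at x)" and "bounded (range (hessian f))"
  obtains L where "L > 0" "L-lipschitz_on UNIV (gradient f)"
proof -
  obtain B where B: "B > 0" "\<And>x. norm (hessian f x) \<le> B"
    using assms(2) by (auto simp: bounded_pos)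
  define L where "L = real CARD('n) * real CARD('n) * B"
  have "\<bar>hessian f x $ i $ j\<bar> \<le> B" for x i j
    using component_le_norm_cart[of "hessian f x $ i" j]
      Finite_Cartesian_Product.norm_nth_le[of "hessian f x" i] B(2)[of x] by linarith
  then have "onorm ((*v) (hessian f x)) \<le> L" for x
    unfolding L_def by (intro onorm_le_matrix_component)
  then have "norm (gradient f x - gradient f y) \<le> L * norm (x - y)" for x y
    using hessian_has_derivative[OF diff]
    by (intro differentiable_bound[of UNIV "gradient f" "\<lambda>x h. hessian f x *v h"]) auto
  moreover have "L > 0" using B(1) by (simp add: L_def)
  ultimately show thesis
    by (intro that[of L]) (auto simp: lipschitz_on_def dist_norm)
qed

theorem mainTheorem5:
  fixes f :: "real^'d \<Rightarrow> real"
  assumes "regular_density f"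
  shows "\<forall>z x\<^sub>0. is_mode f z \<longrightarrow> x\<^sub>0 \<in> basin_of_attraction f z \<longrightarrow>
           (\<exists>\<rho>\<^sub>0>0. \<forall>\<rho>\<in>{0<..\<rho>\<^sub>0}. euler_shift f \<rho> x\<^sub>0 \<longlonglongrightarrow> z)"
proof (intro allI impI)
  fix z x\<^sub>0
  assume mode: "is_mode f z" and basin: "x\<^sub>0 \<in> basin_of_attraction f z"
  let ?F = "gradient f"
  have diff: "\<And>x. f differentiable (at x)" "\<And>x. ?F differentiable (at x)"
    and bdd: "bounded (range ?F)" "bounded (range (hessian f))"
    and inv: "\<And>x. ?F x = 0 \<Longrightarrow> invertible (hessian f x)"
    using assms by (auto simp: regular_density_def twice_differentiable_def bounded_unif_cont_def)
  have grad: "GDERIV f x :> ?F x" for x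
    using diff(1) by (rule GDERIV_gradient)
  obtain L where L: "L > 0" "L-lipschitz_on UNIV ?F"
    using bounded_hessian_lipschitz_gradient[OF diff(2) bdd(2)] by blast
  obtain M where M: "M > 0" "\<And>x. norm (?F x) \<le> M"
    using bdd(1) by (auto simp: bounded_pos)
  have max: "\<forall>\<^sub>F y in nhds z. f y \<le> f z"
    using mode by (simp add: is_mode_def)
  then have zero: "?F z = 0"
    by (rule gradient_zero_at_local_max[OF grad])
  have "inj ((*v) (hessian f z))"
    using inv[OF zero] by (rule inj_matrix_vector_mult)
  then have iso: "\<forall>\<^sub>F x in at z. ?F x \<noteq> 0"
    using hessian_has_derivative[OF diff(2)] zero by (intro injective_derivative_isolated_zero) auto
  obtain U where U: "open U" "z \<in> U"
    "\<And>\<rho> x m. \<lbrakk>0 < \<rho>; \<rho> * L \<le> 1 / 2; \<And>k. x (Suc k) = x k + \<rho> *\<^sub>R ?F (x k); x m \<in> U\<rbrakk>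
      \<Longrightarrow> x \<longlonglongrightarrow> z"
    using strict_local_max_traps_ascent[OF grad L(2) max iso] by blast
  obtain \<gamma> where \<gamma>: "\<gamma> 0 = x\<^sub>0" "(\<gamma> \<longlongrightarrow> z) at_top"
    and flow: "\<And>t. t \<ge> 0 \<Longrightarrow> (\<gamma> has_vector_derivative ?F (\<gamma> t)) (at t within {0..})"
    using basin by (auto simp: basin_of_attraction_def gradient_flow_def)
  have "\<forall>\<^sub>F t in at_top. \<gamma> t \<in> U \<and> t \<ge> 0"
    using topological_tendstoD[OF \<gamma>(2) U(1,2)] eventually_ge_at_top by (rule eventually_conj)
  then obtain T where T: "\<gamma> T \<in> U" "T \<ge> 0"
    by (auto dest: eventually_happens)
  obtain e where e: "e > 0" "\<And>y. dist y (\<gamma> T) \<le> e \<Longrightarrow> y \<in> U"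
    using open_contains_cball[of U] U(1) T(1) by (auto simp: subset_iff dist_commute)
  \<comment> \<open>the first bound makes every step ascend, the second brings the iteration into \<open>U\<close>\<close>
  define \<rho>\<^sub>0 where "\<rho>\<^sub>0 = min (1 / (2 * L)) (e / (M * exp (L * T)))"
  have "euler_shift f \<rho> x\<^sub>0 \<longlonglongrightarrow> z" if \<rho>: "\<rho> \<in> {0<..\<rho>\<^sub>0}" for \<rho>
  proof -
    have small: "\<rho> * L \<le> 1 / 2" "\<rho> * (M * exp (L * T)) \<le> e"
      using \<rho> L(1) M(1) by (auto simp: \<rho>\<^sub>0_def field_simps)
    obtain m where "norm (euler_shift f \<rho> x\<^sub>0 m - \<gamma> T) \<le> \<rho> * (M * exp (L * T))"
      using euler_near_flow[OF flow M(2) L(2), of \<rho> T "euler_shift f \<rho> x\<^sub>0"] \<rho> T(2) \<gamma>(1) by auto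
    then have "euler_shift f \<rho> x\<^sub>0 m \<in> U"
      using small(2) by (intro e(2)) (simp add: dist_norm)
    then show ?thesis
      using \<rho> small(1) by (intro U(3)) auto
  qed
  moreover have "\<rho>\<^sub>0 > 0"
    using L(1) M(1) e(1) by (simp add: \<rho>\<^sub>0_def)
  ultimately show "\<exists>\<rho>\<^sub>0>0. \<forall>\<rho>\<in>{0<..\<rho>\<^sub>0}. euler_shift f \<rho> x\<^sub>0 \<longlonglongrightarrow> z"
    by blast
qed

end
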